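(* Let $S\in M_{2n}(\mathbb{C})$ be symplectic with $\lambda_1\in\sigma(S)$ and let $\mu\in\mathbb{C}\setminus\{0\}$. Let $x_1,x_2\in\mathbb{C}^{2n}$ be eigenvectors of $S$ for $\lambda_1$ and $\lambda_1^{-1}$, respectively, such that $X=[\,x_1\;x_2\,]$ satisfies $X^TJX=J_2$, and let $R=[r_{ij}]\in M_2(\mathbb{C})$ satisfy $$(\mu+\mu^{-1})-(\lambda_1+\lambda_1^{-1}) = \lambda_1r_{12}-\lambda_1^{-1}r_{21}\quad\text{and}\quad 0=r_{12}-r_{21}+r_{11}r_{22}-r_{12}r_{21}.\qquad( * )$$ Let $\hat{S} = S+XRX^TJ^TS = (I_{2n}+XRX^TJ^T)S$ and $\tilde{S} = S(I_{2n}+XRX^TJ^T)$. Then: 1. If $\lambda_1\neq\pm1$, then $\hat{S}=\tilde{S}$ holds if and only if $R$ is one of the matrices $$R_1 = \begin{bmatrix} 0 & \lambda_1^{-1}(\mu-\lambda_1)\\ \mu^{-1}(\mu-\lambda_1) & 0\end{bmatrix},\qquad R_2 = \begin{bmatrix} 0 & \mu^{-1}(\lambda_1^{-1}-\mu)\\ \lambda_1(\lambda_1^{-1}-\mu) & 0\end{bmatrix}.$$ 2. If $\lambda_1=\pm1$, then $\hat{S}=\tilde{S}$ holds for any $R\in M_2(\mathbb{C})$ satisfying $( * )$.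
   Context: $M_n(\mathbb{C})$ is the set of complex $n\times n$ matrices, $\sigma(S)$ is the spectrum, $^T$ is the transpose without conjugation. $J=J_{2n} = \begin{bmatrix} 0 & I_n \\ -I_n & 0\end{bmatrix}$ and $J_2=\begin{bmatrix}0&1\\-1&0\end{bmatrix}$; $S\in M_{2n}(\mathbb{C})$ is symplectic if $S^TJS=J$. *)

theory Defs
  imports Complex_Main "Jordan_Normal_Form.Spectral_Radius"
begin

definition J_mat :: "nat \<Rightarrow> complex mat" where
  "J_mat n = four_block_mat (0\<^sub>m n n) (1\<^sub>m n) (- 1\<^sub>m n) (0\<^sub>m n n)"

definition symplectic :: "nat \<Rightarrow> complex mat \<Rightarrow> bool" where
  "symplectic n S \<longleftrightarrow>
     S \<in> carrier_mat (2 * n) (2 * n) \<and> transpose_mat S * J_mat n * S = J_mat n"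

definition S_hat :: "nat \<Rightarrow> complex mat \<Rightarrow> complex mat \<Rightarrow> complex mat \<Rightarrow> complex mat" where
  "S_hat n S X R = S + X * R * transpose_mat X * transpose_mat (J_mat n) * S"

definition S_tilde :: "nat \<Rightarrow> complex mat \<Rightarrow> complex mat \<Rightarrow> complex mat \<Rightarrow> complex mat" where
  "S_tilde n S X R = S * (1\<^sub>m (2 * n) + X * R * transpose_mat X * transpose_mat (J_mat n))"

lemma J_mat_carrier [simp]: "J_mat n \<in> carrier_mat (2 * n) (2 * n)"
  by (auto simp: J_mat_def)

lemma J_mat_1: "J_mat 1 = mat_of_rows_list 2 [[0, 1], [-1, 0]]"
  by (rule eq_matI) (auto simp: J_mat_def mat_of_rows_list_def less_Suc_eq numeral_2_eq_2)

lemma S_hat_eq: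
  assumes "S \<in> carrier_mat (2 * n) (2 * n)" "X \<in> carrier_mat (2 * n) 2" "R \<in> carrier_mat 2 2"
  shows "S_hat n S X R
    = (1\<^sub>m (2 * n) + X * R * transpose_mat X * transpose_mat (J_mat n)) * S"
proof -
  have "X * R * transpose_mat X * transpose_mat (J_mat n) \<in> carrier_mat (2 * n) (2 * n)"
    using assms
    by (intro mult_carrier_mat[where n = 2] mult_carrier_mat[where n = "2 * n"]) simp_all
  then show ?thesis
    using assms(1)
    by (simp add: S_hat_def add_mult_distrib_mat[OF one_carrier_mat])
qed

end

theory Submission
  imports Defs
begin

text \<open>
  Write \<open>D\<close> for the diagonal matrix with entries \<open>lam\<close> and \<open>inverse lam\<close>, so that \<open>S * X = X * D\<close>,
  and \<open>W = X\<^sup>T * J\<^sup>T\<close>. The columns of \<open>X\<close> are right eigenvectors, and symplecticity turns them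
  into left eigenvectors: \<open>D * (W * S) = X\<^sup>T * S\<^sup>T * J\<^sup>T * S = W\<close>, that is,
  \<open>W * S = D\<^sup>-\<^sup>1 * W\<close>. Hence the two perturbations of \<open>S\<close> differ from \<open>S\<close> by
  \<open>X * (R * D\<^sup>-\<^sup>1) * W\<close> and \<open>X * (D * R) * W\<close>. Since \<open>W * X\<close> is the transpose of the two by two
  symplectic form, which is invertible, \<open>X\<close> and \<open>W\<close> can be cancelled
  (\<open>sandwich_cancel\<close>), and the question becomes whether \<open>R * D\<^sup>-\<^sup>1 = D * R\<close>
  (\<open>S_hat_eq_S_tilde_iff\<close>).

  As \<open>D\<^sup>-\<^sup>1\<close> is \<open>D\<close> with its diagonal entries swapped, this equation always holds off the diagonal;
  on the diagonal it says that \<open>R\<close> vanishes there unless \<open>lam\<close> equals its inverse. This settles the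
  case \<open>lam = 1\<close> or \<open>lam = -1\<close>. In the other case the two scalar equations with
  zero diagonal reduce, for \<open>t = lam * (1 + R $$ (0, 1))\<close>, to \<open>t + inverse t = mu + inverse mu\<close>, whose
  solutions \<open>t = mu\<close> and \<open>t = inverse mu\<close> give the two matrices
  (\<open>off_diagonal_solutions\<close>).
\<close>

section \<open>Reduction to a two by two equation\<close>

lemma mult_mat_of_cols_eigenvectors:
  assumes S: "S \<in> carrier_mat m m"
    and ev: "\<And>j. j < length vs \<Longrightarrow> eigenvector S (vs ! j) (f j)"
  shows "S * mat_of_cols m vs = mat_of_cols m vs * mat_diag (length vs) f"
proof -
  have X: "mat_of_cols m vs \<in> carrier_mat m (length vs)" by simp
  show ?thesis
  proof (rule eq_matI, goal_cases)
    case (1 i j)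
    then have i: "i < m" and j: "j < length vs"
      by (auto simp: mat_diag_def)
    have v: "vs ! j \<in> carrier_vec m" "S *\<^sub>v (vs ! j) = f j \<cdot>\<^sub>v (vs ! j)"
      using ev[OF j] S by (auto simp: eigenvector_def)
    have "(S * mat_of_cols m vs) $$ (i, j) = (S *\<^sub>v (vs ! j)) $ i"
      using i j S v(1) by simp
    also have "\<dots> = f j * (vs ! j) $ i"
      using v i by simp
    finally show ?case
      using i j by (simp add: mat_diag_mult_right[OF X] mat_of_cols_index)
  qed (use S in \<open>auto simp: mat_diag_def\<close>)
qed

text \<open>
  An invertible \<open>W * X\<close> makes \<open>X\<close> left invertible (by \<open>P * W\<close>) and \<open>W\<close> right
  invertible (by \<open>X * P\<close>).
\<close>
lemma sandwich_cancel:
  fixes X :: "'a :: comm_ring_1 mat"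
  assumes X: "X \<in> carrier_mat m k" and W: "W \<in> carrier_mat k m"
    and A: "A \<in> carrier_mat k k" and B: "B \<in> carrier_mat k k" and P: "P \<in> carrier_mat k k"
    and l: "P * (W * X) = 1\<^sub>m k" and r: "(W * X) * P = 1\<^sub>m k"
    and eq: "X * A * W = X * B * W"
  shows "A = B"
proof -
  have recover: "P * W * (X * C * W) * (X * P) = C" if C: "C \<in> carrier_mat k k" for C
  proof -
    have PW: "P * W \<in> carrier_mat k m" and XP: "X * P \<in> carrier_mat m k"
      and XC: "X * C \<in> carrier_mat m k"
      using P W X C by auto
    have "P * W * (X * C * W) = (P * (W * X)) * C * W"
      using assoc_mult_mat[OF PW XC W] assoc_mult_mat[OF PW X C] assoc_mult_mat[OF P W X] by simp
    then have "P * W * (X * C * W) * (X * P) = C * W * (X * P)"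
      using C by (simp add: l)
    also have "\<dots> = C * ((W * X) * P)"
      using assoc_mult_mat[OF C W XP] assoc_mult_mat[OF W X P] by simp
    finally show ?thesis using C by (simp add: r)
  qed
  show ?thesis
    using recover[OF A, unfolded eq, unfolded recover[OF B]] by (rule sym)
qed

text \<open>
  Multiplying \<open>S\<^sup>T * J\<^sup>T * S = J\<^sup>T\<close> by \<open>X\<^sup>T\<close> from the left replaces \<open>S\<^sup>T\<close> by \<open>D\<^sup>T\<close>, so that \<open>E\<close>, the inverse
  of \<open>D\<^sup>T\<close>, is the action of \<open>S\<close> on the rows of \<open>X\<^sup>T * J\<^sup>T\<close>.
\<close>
lemma symplectic_left_action:
  assumes S: "symplectic n S"
    and X: "X \<in> carrier_mat (2 * n) k" and D: "D \<in> carrier_mat k k" and E: "E \<in> carrier_mat k k"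
    and SX: "S * X = X * D" and ED: "E * transpose_mat D = 1\<^sub>m k"
  shows "transpose_mat X * transpose_mat (J_mat n) * S
       = E * (transpose_mat X * transpose_mat (J_mat n))"
proof -
  define K where "K = transpose_mat (J_mat n)"
  have K: "K \<in> carrier_mat (2 * n) (2 * n)" by (simp add: K_def)
  have Sc: "S \<in> carrier_mat (2 * n) (2 * n)"
    and Sy: "transpose_mat S * J_mat n * S = J_mat n"
    using S by (auto simp: symplectic_def)
  have XT: "transpose_mat X \<in> carrier_mat k (2 * n)"
    and ST: "transpose_mat S \<in> carrier_mat (2 * n) (2 * n)"
    and DT: "transpose_mat D \<in> carrier_mat k k"
    using X Sc D by auto
  have "K = transpose_mat (transpose_mat S * J_mat n * S)"
    by (simp add: Sy K_def)
  also have "\<dots> = transpose_mat S * (K * S)"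
    using Sc transpose_mult[of "transpose_mat S * J_mat n" "2*n" "2*n" S "2*n"]
      transpose_mult[of "transpose_mat S" "2*n" "2*n" "J_mat n" "2*n"]
    by (simp add: K_def)
  finally have KS: "K = transpose_mat S * (K * S)" .
  have XS: "transpose_mat X * transpose_mat S = transpose_mat D * transpose_mat X"
    using SX transpose_mult[OF Sc X] transpose_mult[OF X D] by simp
  have KSc: "K * S \<in> carrier_mat (2*n) (2*n)" using K Sc by simp
  have "transpose_mat X * K = (transpose_mat X * transpose_mat S) * (K * S)"
    by (subst KS) (rule assoc_mult_mat[OF XT ST KSc, symmetric])
  also have "\<dots> = transpose_mat D * (transpose_mat X * (K * S))"
    unfolding XS by (rule assoc_mult_mat[OF DT XT KSc])
  finally have "E * (transpose_mat X * K) = E * (transpose_mat D * (transpose_mat X * (K * S)))"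
    by (rule arg_cong)
  also have "\<dots> = transpose_mat X * (K * S)"
    using assoc_mult_mat[OF E DT, of "transpose_mat X * (K * S)" "2*n"] XT KSc
    by (simp add: ED)
  also have "\<dots> = transpose_mat X * K * S"
    by (rule assoc_mult_mat[OF XT K Sc, symmetric])
  finally show ?thesis by (simp add: K_def)
qed

text \<open>
  In \<open>S_hat\<close> the factor \<open>S\<close> meets \<open>X\<^sup>T * J\<^sup>T\<close> and turns into \<open>E\<close>; in \<open>S_tilde\<close> it meets \<open>X\<close> and turns
  into \<open>D\<close>. Both perturbations of \<open>S\<close> thus have the shape required for \<open>sandwich_cancel\<close>.
\<close>
lemma S_hat_eq_S_tilde_iff:
  assumes S: "symplectic n S"
    and X: "X \<in> carrier_mat (2 * n) k" and R: "R \<in> carrier_mat k k"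
    and D: "D \<in> carrier_mat k k" and E: "E \<in> carrier_mat k k" and P: "P \<in> carrier_mat k k"
    and SX: "S * X = X * D" and ED: "E * transpose_mat D = 1\<^sub>m k"
    and l: "P * (transpose_mat X * transpose_mat (J_mat n) * X) = 1\<^sub>m k"
    and r: "(transpose_mat X * transpose_mat (J_mat n) * X) * P = 1\<^sub>m k"
  shows "S_hat n S X R = S_tilde n S X R \<longleftrightarrow> R * E = D * R"
proof -
  define W where "W = transpose_mat X * transpose_mat (J_mat n)"
  have Sc: "S \<in> carrier_mat (2 * n) (2 * n)" using S by (simp add: symplectic_def)
  have Kc: "transpose_mat (J_mat n) \<in> carrier_mat (2 * n) (2 * n)" by simp
  have XT: "transpose_mat X \<in> carrier_mat k (2 * n)" using X by simp
  have W: "W \<in> carrier_mat k (2 * n)" using XT Kc unfolding W_def by simp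
  have XR: "X * R \<in> carrier_mat (2 * n) k" using X R by simp
  have XRW: "X * R * transpose_mat X * transpose_mat (J_mat n) = X * R * W"
    unfolding W_def by (rule assoc_mult_mat[OF XR XT Kc])
  have WS: "W * S = E * W"
    unfolding W_def by (rule symplectic_left_action[OF S X D E SX ED])
  have "X * R * W * S = X * R * (E * W)"
    using assoc_mult_mat[OF XR W Sc] by (simp add: WS)
  also have "\<dots> = X * (R * E) * W"
    using assoc_mult_mat[OF XR E W] assoc_mult_mat[OF X R E] by simp
  finally have hat: "S_hat n S X R = S + X * (R * E) * W"
    by (simp add: S_hat_def XRW)
  have "S * (X * R * W) = S * X * R * W"
    using assoc_mult_mat[OF Sc XR W] assoc_mult_mat[OF Sc X R] by simp
  also have "\<dots> = X * (D * R) * W"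
    using assoc_mult_mat[OF X D R] by (simp add: SX)
  finally have tilde: "S_tilde n S X R = S + X * (D * R) * W"
    using mult_add_distrib_mat[OF Sc one_carrier_mat, of "X * R * W"] Sc XR W
    by (simp add: S_tilde_def XRW)
  have RE: "R * E \<in> carrier_mat k k" and DR: "D * R \<in> carrier_mat k k"
    using R E D by auto
  have c: "X * (R * E) * W \<in> carrier_mat (2*n) (2*n)" "X * (D * R) * W \<in> carrier_mat (2*n) (2*n)"
    using X RE DR W by auto
  have add_cancel: "A = B"
    if eq: "S + A = S + B" and A: "A \<in> carrier_mat (2*n) (2*n)" and B: "B \<in> carrier_mat (2*n) (2*n)"
    for A B
  proof (rule eq_matI)
    fix i j assume "i < dim_row B" "j < dim_col B"
    with A B Sc arg_cong[OF eq, of "\<lambda>M. M $$ (i, j)"] show "A $$ (i, j) = B $$ (i, j)"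
      by simp
  qed (use A B in auto)
  show ?thesis
  proof
    assume "S_hat n S X R = S_tilde n S X R"
    then have "X * (R * E) * W = X * (D * R) * W"
      using add_cancel[OF _ c] by (simp add: hat tilde)
    then show "R * E = D * R"
      using sandwich_cancel[OF X W RE DR P] l r unfolding W_def by simp
  qed (simp add: hat tilde)
qed

section \<open>Solving the two by two equation\<close>

lemma mat_2_2_eq_iff:
  assumes "A \<in> carrier_mat 2 2" "B \<in> carrier_mat 2 2"
  shows "A = B \<longleftrightarrow> A $$ (0, 0) = B $$ (0, 0) \<and> A $$ (0, 1) = B $$ (0, 1)
                 \<and> A $$ (1, 0) = B $$ (1, 0) \<and> A $$ (1, 1) = B $$ (1, 1)"
proof
  assume "A $$ (0, 0) = B $$ (0, 0) \<and> A $$ (0, 1) = B $$ (0, 1)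
        \<and> A $$ (1, 0) = B $$ (1, 0) \<and> A $$ (1, 1) = B $$ (1, 1)"
  then have "A $$ (i, j) = B $$ (i, j)" if "i < 2" "j < 2" for i j
    using that less_2_cases[of i] less_2_cases[of j] by fastforce
  then show "A = B"
    using assms by (intro eq_matI) simp_all
qed simp

lemma anti_diag_iff:
  assumes R: "R \<in> carrier_mat 2 2"
  shows "R = mat_of_rows_list 2 [[0, p], [q, 0]]
    \<longleftrightarrow> R $$ (0, 0) = 0 \<and> R $$ (1, 1) = 0 \<and> R $$ (0, 1) = p \<and> R $$ (1, 0) = q"
proof -
  have len: "length [[0, p], [q, 0]] = 2" by simp
  have c: "mat_of_rows_list 2 [[0, p], [q, 0]] \<in> carrier_mat 2 2"
    unfolding mat_of_rows_list_def len by (rule mat_carrier)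
  show ?thesis
    unfolding mat_2_2_eq_iff[OF R c] by (simp add: mat_of_rows_list_def conj_ac)
qed

text \<open>
  The diagonal entries of the two sides are \<open>r * inverse a\<close> against \<open>a * r\<close> and \<open>r * a\<close> against
  \<open>inverse a * r\<close>, while the off-diagonal entries agree by commutativity.
\<close>
lemma diag_pair_intertwine_iff:
  fixes a :: "'a :: field"
  assumes R: "R \<in> carrier_mat 2 2" and a: "a \<noteq> 0"
  shows "R * mat_diag 2 (\<lambda>i. if i = 0 then inverse a else a)
         = mat_diag 2 (\<lambda>i. if i = 0 then a else inverse a) * R
     \<longleftrightarrow> a = 1 \<or> a = -1 \<or> R $$ (0, 0) = 0 \<and> R $$ (1, 1) = 0"
proof -
  have inv: "inverse a = a \<longleftrightarrow> a = 1 \<or> a = -1"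
    using a by (metis inverse_1 inverse_minus_eq nonzero_inverse_eq_divide
        nonzero_divide_eq_eq square_eq_1_iff)
  have "R * mat_diag 2 (\<lambda>i. if i = 0 then inverse a else a)
         = mat_diag 2 (\<lambda>i. if i = 0 then a else inverse a) * R
     \<longleftrightarrow> R $$ (0, 0) * inverse a = a * R $$ (0, 0) \<and> R $$ (1, 1) * a = inverse a * R $$ (1, 1)"
    by (subst mat_2_2_eq_iff)
      (use R in \<open>auto simp: mat_diag_mult_left[OF R] mat_diag_mult_right[OF R] mult.commute\<close>)
  then show ?thesis using inv by (auto simp: mult.commute)
qed

text \<open>
  The second equation excludes \<open>p = -1\<close> and reads \<open>q = p / (1 + p)\<close>. Substituting \<open>t = a * (1 + p)\<close> in
  the first one gives \<open>t + inverse t = u + inverse u\<close>, that is, \<open>(t - u) * (t * u - 1) = 0\<close>.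
\<close>
lemma off_diagonal_solutions:
  fixes a u p q :: "'a :: field"
  assumes a: "a \<noteq> 0" and u: "u \<noteq> 0"
    and eq1: "(u + inverse u) - (a + inverse a) = a * p - inverse a * q"
    and eq2: "p - q = p * q"
  shows "p = inverse a * (u - a) \<and> q = inverse u * (u - a)
       \<or> p = inverse u * (inverse a - u) \<and> q = a * (inverse a - u)"
proof -
  have q: "q * (1 + p) = p" using eq2 by (simp add: algebra_simps)
  then have p1: "1 + p \<noteq> 0" by auto
  define t where "t = a * (1 + p)"
  have t: "t \<noteq> 0" using a p1 by (simp add: t_def)
  have p_t: "p = inverse a * (t - a)" using a by (simp add: t_def field_simps)
  have "inverse t * t * q = inverse t * (a * (q * (1 + p)))"
    by (simp add: t_def ac_simps)
  also have "\<dots> = inverse t * (t - a)"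
    unfolding q by (simp add: t_def algebra_simps)
  finally have q_t: "q = inverse t * (t - a)" using t by simp
  have "a * p = t - a" using a by (simp add: p_t)
  moreover have "inverse a * q = inverse a - inverse t"
    using a t by (simp add: q_t field_simps)
  ultimately have "u + inverse u = t + inverse t"
    using eq1 by (simp only:) (simp add: algebra_simps)
  then have "(t - u) * (t * u - 1) = 0"
    using u t by (simp add: field_simps)
  then consider "t = u" | "t * u = 1" by auto
  then show ?thesis
  proof cases
    case 1
    then show ?thesis using p_t q_t by simp
  next
    case 2
    then have t_u: "t = inverse u" using u by (simp add: field_simps)
    have "p = inverse u * (inverse a - u)" "q = a * (inverse a - u)"
      unfolding p_t q_t t_u using a u by (simp_all add: algebra_simps)
    then show ?thesis by simp
  qed
qed

text \<open>
  As \<open>inverse 0 = 0\<close>, the value \<open>a = 0\<close> would put both columns of \<open>X\<close> into the kernel of \<open>S\<close>,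
  which is impossible since \<open>S\<close> preserves the form and the form pairs the columns to 1.
\<close>
lemma symplectic_pair_eigenvalue_nonzero:
  assumes S: "symplectic n S" and X: "X \<in> carrier_mat (2 * n) 2"
    and SX: "S * X = X * mat_diag 2 (\<lambda>i. if i = 0 then a else inverse a)"
    and XJX: "transpose_mat X * J_mat n * X = J_mat 1"
  shows "a \<noteq> 0"
proof
  assume a: "a = 0"
  have Sc: "S \<in> carrier_mat (2 * n) (2 * n)"
    and Sy: "transpose_mat S * J_mat n * S = J_mat n"
    using S by (auto simp: symplectic_def)
  have XT: "transpose_mat X \<in> carrier_mat 2 (2 * n)"
    and SJ: "transpose_mat S * J_mat n \<in> carrier_mat (2 * n) (2 * n)"
    using X Sc mult_carrier_mat[OF transpose_carrier_mat[THEN iffD2, OF Sc] J_mat_carrier]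
    by auto
  have "mat_diag 2 (\<lambda>i::nat. if i = 0 then a else inverse a) = 0\<^sub>m 2 2"
    by (rule eq_matI) (auto simp: mat_diag_def a)
  then have SX0: "S * X = 0\<^sub>m (2 * n) 2"
    using SX X by simp
  have "J_mat n * X = transpose_mat S * J_mat n * (S * X)"
    using assoc_mult_mat[OF SJ Sc X] by (simp add: Sy)
  also have "\<dots> = 0\<^sub>m (2 * n) 2"
    unfolding SX0 using SJ by (rule right_mult_zero_mat)
  finally have "J_mat 1 = 0\<^sub>m 2 2"
    using assoc_mult_mat[OF XT J_mat_carrier X] XT by (simp add: XJX)
  then have "J_mat 1 $$ (0, 1) = 0" by simp
  then show False unfolding J_mat_1 by (simp add: mat_of_rows_list_def)
qed

lemma J_mat_1_orthogonal:
  "J_mat 1 * transpose_mat (J_mat 1) = 1\<^sub>m 2"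
  "transpose_mat (J_mat 1) * J_mat 1 = 1\<^sub>m 2"
proof -
  have c: "J_mat 1 \<in> carrier_mat 2 2" using J_mat_carrier[of 1] by simp
  have p: "J_mat 1 * transpose_mat (J_mat 1) \<in> carrier_mat 2 2"
    "transpose_mat (J_mat 1) * J_mat 1 \<in> carrier_mat 2 2"
    using c by auto
  have two: "{0..<2::nat} = {0, 1}" by auto
  show "J_mat 1 * transpose_mat (J_mat 1) = 1\<^sub>m 2" "transpose_mat (J_mat 1) * J_mat 1 = 1\<^sub>m 2"
    unfolding mat_2_2_eq_iff[OF p(1) one_carrier_mat] mat_2_2_eq_iff[OF p(2) one_carrier_mat]
    unfolding J_mat_1 by (simp_all add: mat_of_rows_list_def scalar_prod_def two)
qed

theorem theorem7:
  fixes n :: nat and S X R :: "complex mat" and x1 x2 :: "complex vec"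
    and lam mu :: complex
  assumes "symplectic n S"
    and "lam \<in> spectrum S"
    and "mu \<noteq> 0"
    and "eigenvector S x1 lam"
    and "eigenvector S x2 (inverse lam)"
    and "X = mat_of_cols (2 * n) [x1, x2]"
    and "transpose_mat X * J_mat n * X = J_mat 1"
    and "R \<in> carrier_mat 2 2"
    and "(mu + inverse mu) - (lam + inverse lam)
           = lam * R $$ (0, 1) - inverse lam * R $$ (1, 0)"
    and "0 = R $$ (0, 1) - R $$ (1, 0) + R $$ (0, 0) * R $$ (1, 1) - R $$ (0, 1) * R $$ (1, 0)"
  shows "(lam \<noteq> 1 \<and> lam \<noteq> -1 \<longrightarrow>
            (S_hat n S X R = S_tilde n S X R \<longleftrightarrow>
              R = mat_of_rows_list 2
                    [[0, inverse lam * (mu - lam)],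
                     [inverse mu * (mu - lam), 0]] \<or>
              R = mat_of_rows_list 2
                    [[0, inverse mu * (inverse lam - mu)],
                     [lam * (inverse lam - mu), 0]]))
       \<and> (lam = 1 \<or> lam = -1 \<longrightarrow> S_hat n S X R = S_tilde n S X R)"
proof -
  define d where "d = (\<lambda>i::nat. if i = 0 then lam else inverse lam)"
  define e where "e = (\<lambda>i::nat. if i = 0 then inverse lam else lam)"
  note S = assms(1) and R = assms(8)
  have Sc: "S \<in> carrier_mat (2 * n) (2 * n)" using S by (simp add: symplectic_def)
  have two: "length [x1, x2] = 2" by simp
  have X: "X \<in> carrier_mat (2 * n) 2"
    unfolding assms(6) by (rule mat_of_cols_carrier(1)[of "2 * n" "[x1, x2]", unfolded two])
  have "S * mat_of_cols (2 * n) [x1, x2]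
      = mat_of_cols (2 * n) [x1, x2] * mat_diag (length [x1, x2]) d"
    by (rule mult_mat_of_cols_eigenvectors[OF Sc])
      (use assms(4,5) in \<open>auto simp: d_def less_Suc_eq\<close>)
  then have SX: "S * X = X * mat_diag 2 d"
    unfolding assms(6) two .
  have lam: "lam \<noteq> 0"
    using symplectic_pair_eigenvalue_nonzero[OF S X SX[unfolded d_def] assms(7)] .
  have "transpose_mat (mat_diag 2 d) = mat_diag 2 d"
    by (rule eq_matI) (auto simp: mat_diag_def)
  moreover have "(\<lambda>i. e i * d i) = (\<lambda>_. 1)"
    using lam by (auto simp: d_def e_def)
  ultimately have ED: "mat_diag 2 e * transpose_mat (mat_diag 2 d) = 1\<^sub>m 2"
    by simp
  have XT: "transpose_mat X \<in> carrier_mat 2 (2 * n)" using X by simp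
  have Jc: "J_mat 1 \<in> carrier_mat 2 2" using J_mat_carrier[of 1] by simp
  have KT: "transpose_mat (J_mat n) \<in> carrier_mat (2 * n) (2 * n)" by simp
  have "transpose_mat (J_mat 1) = transpose_mat X * transpose_mat (transpose_mat X * J_mat n)"
    unfolding assms(7)[symmetric]
    by (rule transpose_mult[OF mult_carrier_mat[OF XT J_mat_carrier] X])
  also have "transpose_mat (transpose_mat X * J_mat n) = transpose_mat (J_mat n) * X"
    unfolding transpose_mult[OF XT J_mat_carrier] by simp
  also have "transpose_mat X * (transpose_mat (J_mat n) * X)
      = transpose_mat X * transpose_mat (J_mat n) * X"
    by (rule assoc_mult_mat[OF XT KT X, symmetric])
  finally have WX: "transpose_mat X * transpose_mat (J_mat n) * X = transpose_mat (J_mat 1)" ..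
  have iff: "S_hat n S X R = S_tilde n S X R
      \<longleftrightarrow> lam = 1 \<or> lam = -1 \<or> R $$ (0, 0) = 0 \<and> R $$ (1, 1) = 0"
    unfolding S_hat_eq_S_tilde_iff[OF S X R mat_diag_dim mat_diag_dim Jc SX ED,
        unfolded WX, OF J_mat_1_orthogonal]
    unfolding d_def e_def by (rule diag_pair_intertwine_iff[OF R lam])
  have "R $$ (0, 1) = inverse lam * (mu - lam) \<and> R $$ (1, 0) = inverse mu * (mu - lam)
      \<or> R $$ (0, 1) = inverse mu * (inverse lam - mu) \<and> R $$ (1, 0) = lam * (inverse lam - mu)"
    if "R $$ (0, 0) = 0"
  proof (rule off_diagonal_solutions[OF lam assms(3,9)])
    show "R $$ (0, 1) - R $$ (1, 0) = R $$ (0, 1) * R $$ (1, 0)"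
      using assms(10) by (simp add: that)
  qed
  then show ?thesis
    unfolding iff anti_diag_iff[OF R] by blast
qed

end
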